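(* Let $0<s<1$. There is a constant $c>0$ such that for every $f\in\mathcal{S}(\mathscr{H})$: the $s$-dyadic energy $\mathscr{E}^\delta_s(f)$ is finite if and only if $\boldsymbol{\nabla}^s_{dy}f\in L^2(\mathbb{R}^+,\ell^2(\mathbb{Z}^+))$, and moreover $$\mathscr{E}^\delta_s(f)=c\,\big\|\,|\boldsymbol{\nabla}^s_{dy}f|_{\ell^2}\,\big\|^2_{L^2}=c\sum_{i\ge0}\|D^s_{(i)}f\|_2^2 .$$
   Context: $\mathbb{R}^+=[0,\infty)$ with Lebesgue measure; $\mathbb{Z}^+$ is the set of nonnegative integers; functions are real valued. Dyadic intervals: for $j\in\mathbb{Z}$, $k\in\mathbb{Z}^+$, $I^j_k=[k2^{-j},(k+1)2^{-j})$; $\mathcal{D}$ is the family of all of them. For $x\ne y$ in $\mathbb{R}^+$, $I(x,y)$ is the smallest interval in $\mathcal{D}$ containing both $x$ and $y$; $\delta(x,y)=|I(x,y)|$ and $\delta(x,x)=0$. Haar system: $h^0_0=\mathcal{X}_{[0,1/2)}-\mathcal{X}_{[1/2,1)}$, $h^j_k(x)=2^{j/2}h^0_0(2^jx-k)$, $\mathscr{H}=\{h^j_k:j\in\mathbb{Z},k\ge0\}$ (an orthonormal basis of $L^2(\mathbb{R}^+)$), and $\mathcal{S}(\mathscr{H})$ is the linear span (finite linear combinations) of $\mathscr{H}$; $\langle f,h\rangle=\int_{\mathbb{R}^+}fh\,dx$. The $i$-th partial dyadic derivative of order $s$ ($i\ge0$) is $D^s_{(i)}f=\sum_{j\in\mathbb{Z}}2^{sj}\langle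 f,h^j_i\rangle h^j_i$; the gradient is $\boldsymbol{\nabla}^s_{dy}f=(D^s_{(i)}f:\ i\ge0)$. The $s$-dyadic energy is $$\mathscr{E}^\delta_s(f)=\iint_{\mathbb{R}^+\times\mathbb{R}^+}\left|\frac{f(x)-f(y)}{\delta(x,y)^s}\right|^2\frac{dx\,dy}{\delta(x,y)}.$$ *)

theory Defs
  imports "HOL-Analysis.Analysis"
begin

text \<open>Functions on \<open>\<real>\<^sup>+ = [0,\<infinity>)\<close> are represented by total functions of type
  \<^typ>\<open>real \<Rightarrow> real\<close>, integrated over \<open>[0,\<infinity>)\<close>.  The Borel restriction of Lebesgue measure
  suffices, since every function in the span of the Haar system is Borel measurable.\<close>

abbreviation leb_pos :: "real measure" where
  "leb_pos \<equiv> restrict_space lborel {0..}"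

definition dyadic_interval :: "int \<Rightarrow> nat \<Rightarrow> real set" where
  "dyadic_interval j k = {real k * 2 powi (- j) ..< (real k + 1) * 2 powi (- j)}"

definition dyadic_intervals :: "real set set" where
  "dyadic_intervals = {dyadic_interval j k | j k. True}"

definition smallest_dyadic :: "real \<Rightarrow> real \<Rightarrow> real set" where
  "smallest_dyadic x y =
     (THE I. I \<in> dyadic_intervals \<and> x \<in> I \<and> y \<in> I \<and>
             (\<forall>J\<in>dyadic_intervals. x \<in> J \<and> y \<in> J \<longrightarrow> I \<subseteq> J))"

definition dyadic_dist :: "real \<Rightarrow> real \<Rightarrow> real" where
  "dyadic_dist x y = (if x = y then 0 else measure lborel (smallest_dyadic x y))"

definition haar00 :: "real \<Rightarrow> real" where
  "haar00 x = indicator {0..<1/2} x - indicator {1/2..<1} x"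

definition haar :: "int \<Rightarrow> nat \<Rightarrow> real \<Rightarrow> real" where
  "haar j k x = 2 powr (real_of_int j / 2) * haar00 (2 powi j * x - real k)"

text \<open>\<open>haar\<close> is injective in its pair of indices, so a finite linear combination of Haar
  functions is indexed by a finite set of pairs \<open>(j,k)\<close>.\<close>

definition haar_span :: "(real \<Rightarrow> real) set" where
  "haar_span = {f. \<exists>(A :: (int \<times> nat) set) (a :: int \<Rightarrow> nat \<Rightarrow> real).
                     finite A \<and> f = (\<lambda>x. \<Sum>(j,k)\<in>A. a j k * haar j k x)}"

definition inner_L2 :: "(real \<Rightarrow> real) \<Rightarrow> (real \<Rightarrow> real) \<Rightarrow> real" where
  "inner_L2 f g = (LINT x|leb_pos. f x * g x)"

text \<open>The series over \<open>j\<close> is summed pointwise.  For \<open>f\<close> in \<open>haar_span\<close> only finitely many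
  coefficients are nonzero, so the mode of convergence is immaterial.\<close>

definition dyadic_deriv :: "real \<Rightarrow> nat \<Rightarrow> (real \<Rightarrow> real) \<Rightarrow> real \<Rightarrow> real" where
  "dyadic_deriv s i f x =
     (\<Sum>\<^sub>\<infinity>j\<in>(UNIV :: int set). 2 powr (s * real_of_int j) * inner_L2 f (haar j i) * haar j i x)"

definition dyadic_gradient :: "real \<Rightarrow> (real \<Rightarrow> real) \<Rightarrow> real \<Rightarrow> nat \<Rightarrow> real" where
  "dyadic_gradient s f x = (\<lambda>i. dyadic_deriv s i f x)"

text \<open>Squared norms take values in \<open>[0,\<infinity>]\<close>, so that they are meaningful without any
  summability or integrability assumption.\<close>

definition ell2_norm_sq :: "(nat \<Rightarrow> real) \<Rightarrow> ennreal" where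
  "ell2_norm_sq a = (\<Sum>i. ennreal ((a i)\<^sup>2))"

definition L2_norm_sq :: "(real \<Rightarrow> real) \<Rightarrow> ennreal" where
  "L2_norm_sq g = (\<integral>\<^sup>+x. ennreal ((g x)\<^sup>2) \<partial>leb_pos)"

definition L2_ell2_norm_sq :: "(real \<Rightarrow> nat \<Rightarrow> real) \<Rightarrow> ennreal" where
  "L2_ell2_norm_sq F = (\<integral>\<^sup>+x. ell2_norm_sq (F x) \<partial>leb_pos)"

text \<open>As \<open>\<ell>\<^sup>2\<close> is separable, measurability of an \<open>\<ell>\<^sup>2\<close>-valued function is
  measurability of its components.  Finiteness of the norm forces \<open>F x \<in> \<ell>\<^sup>2\<close> for almost
  every \<open>x\<close>.\<close>

definition L2_ell2 :: "(real \<Rightarrow> nat \<Rightarrow> real) set" where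
  "L2_ell2 = {F. (\<forall>i. (\<lambda>x. F x i) \<in> borel_measurable leb_pos) \<and> L2_ell2_norm_sq F < \<infinity>}"

text \<open>On the diagonal, a null set, the integrand is \<open>0\<close> because division by \<open>0\<close> yields \<open>0\<close>.\<close>

definition dyadic_energy :: "real \<Rightarrow> (real \<Rightarrow> real) \<Rightarrow> ennreal" where
  "dyadic_energy s f =
     (\<integral>\<^sup>+(x, y). ennreal (\<bar>(f x - f y) / dyadic_dist x y powr s\<bar>\<^sup>2 / dyadic_dist x y)
        \<partial>(leb_pos \<Otimes>\<^sub>M leb_pos))"

end

theory Submission
  imports Defs
begin

text \<open>The energy is the squared \<open>L\<^sup>2\<close> norm over pairs \<open>(x, y)\<close> of the difference
  \<open>f x - f y\<close> divided by \<open>dyadic_dist x y powr (s + 1/2)\<close>. Under the linear map from \<open>f\<close> to this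
  weighted difference the Haar functions stay orthogonal, because the distance to a fixed point
  outside a dyadic interval is constant on that interval. The squared norm of the image of
  \<open>haar j k\<close> is a constant times \<open>2 powr (2 * s * j)\<close>. By Pythagoras, the energy and the norm of
  the gradient are both weighted sums of squares of the Haar coefficients, with proportional
  weights.\<close>

subsection \<open>The dyadic distance\<close>

text \<open>For nonnegative \<open>x\<close> this numbers the interval of length
  \<open>2 powi (- n)\<close> around \<open>x\<close>. Integer values let floor and
  \<open>div\<close> apply without sign conditions, and turn membership and nesting of dyadic
  intervals into equations between indices.\<close>

definition level_index :: "int \<Rightarrow> real \<Rightarrow> int" where
  "level_index n x = \<lfloor>2 powi n * x\<rfloor>"

lemma measurable_level_index [measurable]:
  "level_index n \<in> measurable borel (count_space UNIV)"
  unfolding level_index_def by measurable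

lemma mem_dyadic_interval_iff: "x \<in> dyadic_interval n k \<longleftrightarrow> level_index n x = int k"
  by (auto simp: dyadic_interval_def level_index_def floor_eq_iff power_int_minus field_simps)

lemma level_index_nonneg: "x \<ge> 0 \<Longrightarrow> level_index n x \<ge> 0"
  by (simp add: level_index_def)

text \<open>Dividing by a positive integer before taking the floor amounts to \<open>div\<close>
  afterwards. The nesting of dyadic intervals comes down to this.\<close>

lemma level_index_diff: "level_index (n - int m) x = level_index n x div 2 ^ m"
proof -
  have "2 powi (n - int m) * x = (2 powi n * x) / real_of_int (2 ^ m)"
    by (simp add: power_int_diff)
  then show ?thesis
    unfolding level_index_def by (simp only: floor_divide_real_eq_div[of "2 ^ m"] zero_le_power zero_le_numeral)
qed

lemma level_index_eq_coarser:
  assumes "level_index n x = level_index n y" "m \<le> n"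
  shows "level_index m x = level_index m y"
  using level_index_diff[of n "nat (n - m)"] assms by simp

text \<open>Both points lie in \<open>[0, 2 ^ m)\<close> for some \<open>m\<close>. Signs matter: a
  negative and a nonnegative number never share an index.\<close>

lemma level_index_eq_coarse:
  assumes "x \<ge> 0" "y \<ge> 0"
  shows "\<exists>n. level_index n x = level_index n y"
proof -
  obtain m where m: "max x y < 2 ^ m"
    using real_arch_pow[of 2 "max x y"] by auto
  have "level_index (- int m) z = 0" if "z \<ge> 0" "z < 2 ^ m" for z
    using that by (auto simp: level_index_def floor_eq_iff power_int_minus field_simps)
  with m assms show ?thesis by (intro exI[of _ "- int m"]) simp
qed

text \<open>Scaling by a power of two above \<open>1 / \<bar>x - y\<bar>\<close> moves the points
  more than \<open>1\<close> apart, so their floors differ.\<close>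

lemma level_index_neq_fine:
  assumes "x \<noteq> y"
  shows "\<exists>n. level_index n x \<noteq> level_index n y"
proof -
  obtain m where m: "1 / \<bar>x - y\<bar> < 2 ^ m"
    using real_arch_pow[of 2 "1 / \<bar>x - y\<bar>"] by auto
  moreover have "\<bar>2 ^ m * x - 2 ^ m * y\<bar> = 2 ^ m * \<bar>x - y\<bar>"
    by (simp add: abs_mult flip: right_diff_distrib)
  ultimately have "1 < \<bar>2 ^ m * x - 2 ^ m * y\<bar>"
    using assms by (simp add: field_simps)
  then have "level_index (int m) x \<noteq> level_index (int m) y"
    unfolding level_index_def power_int_of_nat by linarith
  then show ?thesis by blast
qed

text \<open>The level of the smallest interval around two distinct nonnegative points. It is a
  relation rather than a function because equal points have no such level.\<close>

definition last_common_level :: "real \<Rightarrow> real \<Rightarrow> int \<Rightarrow> bool" where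
  "last_common_level x y n \<longleftrightarrow>
     level_index n x = level_index n y \<and> level_index (n + 1) x \<noteq> level_index (n + 1) y"

text \<open>Agreement passes to coarser levels and disagreement to finer ones, so the levels
  \<open>n\<close> and \<open>n + 1\<close> decide all others.\<close>

lemma last_common_level_iff:
  assumes "last_common_level x y n"
  shows "level_index m x = level_index m y \<longleftrightarrow> m \<le> n"
  using assms level_index_eq_coarser[of n x y m] level_index_eq_coarser[of m x y "n + 1"]
  unfolding last_common_level_def by force

lemma ex_last_common_level:
  assumes "x \<ge> 0" "y \<ge> 0" "x \<noteq> y"
  shows "\<exists>n. last_common_level x y n"
proof -
  obtain l where l: "level_index l x = level_index l y"
    using level_index_eq_coarse assms by blast
  obtain u where u: "level_index u x \<noteq> level_index u y"
    using level_index_neq_fine assms by blast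
  have "l < u" using l u level_index_eq_coarser by (meson not_less)
  \<comment> \<open>The integers are not well-ordered, so the first disagreement is counted by a
    natural number from the common level \<open>l\<close>; the level just before it is the last
    common one.\<close>
  define m where "m = (LEAST i. level_index (l + int i) x \<noteq> level_index (l + int i) y)"
  have "level_index (l + int (nat (u - l))) x \<noteq> level_index (l + int (nat (u - l))) y"
    using u \<open>l < u\<close> by simp
  then have m: "level_index (l + int m) x \<noteq> level_index (l + int m) y"
    unfolding m_def by (rule LeastI)
  then obtain i where i: "m = Suc i"
    using l by (cases m) auto
  then have "level_index (l + int i) x = level_index (l + int i) y"
    using not_less_Least[of i "\<lambda>i. level_index (l + int i) x \<noteq> level_index (l + int i) y"]
    unfolding m_def by auto
  with m i show ?thesis
    unfolding last_common_level_def by (intro exI[of _ "l + int i"]) (simp add: add_ac)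
qed

lemma last_common_level_unique:
  "last_common_level x y n \<Longrightarrow> last_common_level x y m \<Longrightarrow> n = m"
  using last_common_level_iff[of x y n] last_common_level_iff[of x y m] by (meson order.antisym order_refl)

lemma measure_dyadic_interval:
  "measure lborel (dyadic_interval n k) = 2 powi (- n)"
  "emeasure lborel (dyadic_interval n k) = ennreal (2 powi (- n))"
  by (auto simp: dyadic_interval_def algebra_simps)

text \<open>A dyadic interval around both points has level at most \<open>n\<close>, so by nesting
  it includes the interval of level \<open>n\<close> around \<open>x\<close>.\<close>

lemma smallest_dyadic_eq:
  assumes "x \<ge> 0" and n: "last_common_level x y n"
  shows "smallest_dyadic x y = dyadic_interval n (nat (level_index n x))"
  unfolding smallest_dyadic_def
proof (rule the_equality)
  let ?I = "dyadic_interval n (nat (level_index n x))"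
  have mem: "z \<in> ?I \<longleftrightarrow> level_index n z = level_index n x" for z
    using level_index_nonneg[OF assms(1)] by (simp add: mem_dyadic_interval_iff)
  have sub: "?I \<subseteq> J" if "J \<in> dyadic_intervals" "x \<in> J" "y \<in> J" for J
  proof -
    obtain m k where J: "J = dyadic_interval m k"
      using \<open>J \<in> dyadic_intervals\<close> by (auto simp: dyadic_intervals_def)
    then have "m \<le> n"
      using that last_common_level_iff[OF n, of m] by (simp add: mem_dyadic_interval_iff)
    show ?thesis
    proof
      fix z assume "z \<in> ?I"
      then have "level_index m z = level_index m x"
        using level_index_eq_coarser[of n z x m] \<open>m \<le> n\<close> by (simp add: mem)
      then show "z \<in> J"
        using \<open>x \<in> J\<close> by (simp add: J mem_dyadic_interval_iff)
    qed
  qed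
  have "?I \<in> dyadic_intervals" by (auto simp: dyadic_intervals_def)
  moreover have "x \<in> ?I" "y \<in> ?I"
    using n unfolding mem last_common_level_def by auto
  ultimately show *: "?I \<in> dyadic_intervals \<and> x \<in> ?I \<and> y \<in> ?I \<and>
      (\<forall>J\<in>dyadic_intervals. x \<in> J \<and> y \<in> J \<longrightarrow> ?I \<subseteq> J)"
    using sub by blast
  fix J assume "J \<in> dyadic_intervals \<and> x \<in> J \<and> y \<in> J \<and>
    (\<forall>K\<in>dyadic_intervals. x \<in> K \<and> y \<in> K \<longrightarrow> J \<subseteq> K)"
  with * show "J = ?I" by blast
qed

lemma dyadic_dist_eq:
  assumes "x \<ge> 0" "last_common_level x y n"
  shows "dyadic_dist x y = 2 powi (- n)"
proof -
  have "x \<noteq> y" using assms by (auto simp: last_common_level_def)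
  then show ?thesis
    by (simp add: dyadic_dist_def smallest_dyadic_eq[OF assms] measure_dyadic_interval)
qed

lemma dyadic_dist_commute: "dyadic_dist x y = dyadic_dist y x"
  by (simp add: dyadic_dist_def smallest_dyadic_def conj_commute conj_left_commute)

text \<open>Up to level \<open>j\<close> the points \<open>x\<close> and \<open>x'\<close> have the
  same index; beyond it neither shares an index with \<open>y\<close>, which lies outside the
  interval. Hence both have the same last common level with \<open>y\<close>. The orthogonality of
  the weighted differences rests on this.\<close>

lemma dyadic_dist_const_off_interval:
  assumes "x \<in> dyadic_interval j k" "x' \<in> dyadic_interval j k" "y \<notin> dyadic_interval j k"
    and "x \<ge> 0" "x' \<ge> 0" "y \<ge> 0"
  shows "dyadic_dist x y = dyadic_dist x' y"
proof -
  have eq: "level_index n x = level_index n y \<longleftrightarrow> level_index n x' = level_index n y" for n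
  proof (cases "n \<le> j")
    case True
    then have "level_index n x = level_index n x'"
      using assms level_index_eq_coarser[of j x x' n] by (simp add: mem_dyadic_interval_iff)
    then show ?thesis by simp
  next
    case False
    then show ?thesis
      using assms level_index_eq_coarser[of n x y j] level_index_eq_coarser[of n x' y j]
      by (auto simp: mem_dyadic_interval_iff)
  qed
  have "x \<noteq> y" using assms by blast
  then obtain n where n: "last_common_level x y n"
    using ex_last_common_level assms by blast
  then have "last_common_level x' y n"
    by (simp add: last_common_level_def eq)
  with n show ?thesis using dyadic_dist_eq assms by metis
qed

section \<open>Measurability of the dyadic distance\<close>

lemma measurable_restrict_space_id [measurable]: "(\<lambda>x. x) \<in> measurable leb_pos borel"
  by (rule measurable_restrict_space1) simp

text \<open>The set-valued description in the definition is bypassed: off the diagonal the distance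
  depends only on the last common level, an integer singled out by a measurable predicate that holds
  for at most one value.\<close>

lemma dyadic_dist_measurable [measurable]:
  "(\<lambda>p. dyadic_dist (fst p) (snd p)) \<in> borel_measurable (leb_pos \<Otimes>\<^sub>M leb_pos)"
proof -
  have [measurable]: "(\<lambda>p. THE n. last_common_level (fst p) (snd p) n)
      \<in> measurable (leb_pos \<Otimes>\<^sub>M leb_pos) (count_space UNIV)"
  proof (rule measurable_THE[where I = UNIV])
    fix n :: int
    have "level_index m \<in> measurable leb_pos (count_space UNIV)" for m
      using measurable_compose[OF measurable_restrict_space_id measurable_level_index] by simp
    note [measurable] = this
    show "Measurable.pred (leb_pos \<Otimes>\<^sub>M leb_pos) (\<lambda>p. last_common_level (fst p) (snd p) n)"
      unfolding last_common_level_def by measurable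
  qed (use last_common_level_unique in auto)
  have [measurable]: "fst \<in> borel_measurable (leb_pos \<Otimes>\<^sub>M leb_pos)"
    using measurable_compose[OF measurable_fst measurable_restrict_space_id] by simp
  have [measurable]: "snd \<in> borel_measurable (leb_pos \<Otimes>\<^sub>M leb_pos)"
    using measurable_compose[OF measurable_snd measurable_restrict_space_id] by simp
  have *: "dyadic_dist (fst p) (snd p) = (if fst p = snd p then 0
        else 2 powi (- (THE n. last_common_level (fst p) (snd p) n)))"
    if "p \<in> space (leb_pos \<Otimes>\<^sub>M leb_pos)" for p
  proof (cases "fst p = snd p")
    case False
    have nn: "fst p \<ge> 0" "snd p \<ge> 0"
      using that by (auto simp: space_pair_measure space_restrict_space)
    then obtain n where n: "last_common_level (fst p) (snd p) n"
      using False ex_last_common_level by blast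
    then have "(THE n. last_common_level (fst p) (snd p) n) = n"
      using last_common_level_unique by blast
    then show ?thesis
      using dyadic_dist_eq[OF nn(1) n] False by simp
  qed (simp add: dyadic_dist_def)
  show ?thesis
    by (subst measurable_cong[OF *]) measurable
qed

subsection \<open>The Haar system\<close>

lemma dyadic_interval_borel [measurable]: "dyadic_interval n k \<in> sets borel"
  by (simp add: dyadic_interval_def)

lemma dyadic_interval_pos: "dyadic_interval n k \<subseteq> {0..}"
  by (auto simp: dyadic_interval_def intro: order_trans[rotated])

lemma emeasure_leb_pos_dyadic_interval [simp]:
  "emeasure leb_pos (dyadic_interval n k) = ennreal (2 powi (- n))"
  "measure leb_pos (dyadic_interval n k) = 2 powi (- n)"
  using dyadic_interval_pos[of n k]
  by (simp_all add: emeasure_restrict_space measure_restrict_space measure_dyadic_interval)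

lemma dyadic_interval_Int_atLeast_0 [simp]: "dyadic_interval n k \<inter> {0..} = dyadic_interval n k"
  using dyadic_interval_pos by blast

lemma dyadic_interval_leb_pos [measurable]: "dyadic_interval n k \<in> sets leb_pos"
  using dyadic_interval_pos by (auto simp: sets_restrict_space_iff)

lemma integrable_indicator_dyadic_interval [simp]:
  "integrable leb_pos (indicator (dyadic_interval n k) :: real \<Rightarrow> real)"
  by (intro integrable_real_indicator) auto

text \<open>The halves of interval \<open>k\<close> at level \<open>j\<close> are the intervals
  \<open>2 * k\<close> and \<open>2 * k + 1\<close> at level \<open>j + 1\<close>, so the index one
  level finer determines the value.\<close>

lemma haar_level_index:
  "haar j k x = 2 powr (j / 2) *
     (if level_index (j + 1) x = 2 * int k then 1
      else if level_index (j + 1) x = 2 * int k + 1 then -1 else 0)"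
proof -
  have "level_index (j + 1) x = \<lfloor>2 * (2 powi j * x)\<rfloor>"
    by (simp add: level_index_def power_int_add_1 mult_ac)
  then show ?thesis
    by (auto simp: haar_def haar00_def indicator_def floor_eq_iff split: if_splits)
qed

lemma haar_measurable_borel [measurable]: "haar j k \<in> borel_measurable borel"
  unfolding haar_level_index[abs_def] by measurable

lemma haar_measurable [measurable]: "haar j k \<in> borel_measurable leb_pos"
  by (rule measurable_restrict_space1) simp

lemma haar_eq_indicators:
  "haar j k x = 2 powr (j / 2) *
     (indicator (dyadic_interval (j + 1) (2 * k)) x - indicator (dyadic_interval (j + 1) (2 * k + 1)) x)"
  by (simp add: haar_level_index indicator_def mem_dyadic_interval_iff)

lemma level_index_child:
  "level_index j x = int k \<longleftrightarrow> level_index (j + 1) x = 2 * int k \<or> level_index (j + 1) x = 2 * int k + 1"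
  using level_index_diff[of "j + 1" 1 x] by auto

lemma haar_sq: "(haar j k x)\<^sup>2 = 2 powi j * indicator (dyadic_interval j k) x"
proof -
  have "(2 powr (real_of_int j / 2))\<^sup>2 = (2::real) powi j"
    by (simp add: power2_eq_square powr_real_of_int' flip: powr_add)
  then show ?thesis
    by (auto simp: haar_level_index indicator_def mem_dyadic_interval_iff level_index_child power_mult_distrib)
qed

lemma haar_outside: "x \<notin> dyadic_interval j k \<Longrightarrow> haar j k x = 0"
  using haar_sq[of j k x] by simp

text \<open>For \<open>i < j\<close> an interval of level \<open>j\<close> has a single index at
  level \<open>i + 1\<close>, which fixes the value. For \<open>i = j\<close> the two intervals are
  disjoint and both values are \<open>0\<close>.\<close>

lemma haar_const:
  assumes "i \<le> j" "(i, k) \<noteq> (j, l)" "x \<in> dyadic_interval j l" "y \<in> dyadic_interval j l"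
  shows "haar i k x = haar i k y"
proof (cases "i = j")
  case True
  then show ?thesis
    using assms haar_outside[of _ i k] by (simp add: mem_dyadic_interval_iff)
next
  case False
  then have "level_index (i + 1) x = level_index (i + 1) y"
    using assms level_index_eq_coarser[of j x y "i + 1"] by (simp add: mem_dyadic_interval_iff)
  then show ?thesis by (simp add: haar_level_index)
qed

lemma haar_integrable [simp]: "integrable leb_pos (haar j k)"
  and haar_integral [simp]: "integral\<^sup>L leb_pos (haar j k) = 0"
  unfolding haar_eq_indicators[abs_def] by simp_all

lemma haar_sq_integrable [simp]: "integrable leb_pos (\<lambda>x. (haar j k x)\<^sup>2)"
  and haar_sq_integral [simp]: "(LINT x|leb_pos. (haar j k x)\<^sup>2) = 1"
  unfolding haar_sq by (simp_all add: power_int_minus)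

lemma haar_mult_integral_0:
  assumes c: "\<And>x. x \<in> dyadic_interval j l \<Longrightarrow> g x = c"
  shows "(LINT x|leb_pos. g x * haar j l x) = 0"
proof -
  have "g x * haar j l x = c * haar j l x" for x
    using c haar_outside[of x j l] by (cases "x \<in> dyadic_interval j l") auto
  then have "(LINT x|leb_pos. g x * haar j l x) = (LINT x|leb_pos. c * haar j l x)"
    by (simp only:)
  then show ?thesis by simp
qed

lemma haar_orthogonal:
  assumes "(i, k) \<noteq> (j, l)"
  shows "(LINT x|leb_pos. haar i k x * haar j l x) = 0"
proof -
  \<comment> \<open>By symmetry the coarser function may stand first. It is constant on the support
    of the finer one, which has mean \<open>0\<close>.\<close>
  have *: "(LINT x|leb_pos. haar i k x * haar j l x) = 0" if "i \<le> j" "(i, k) \<noteq> (j, l)" for i k j l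
  proof -
    \<comment> \<open>The left endpoint supplies the constant value.\<close>
    have "real l * 2 powi - j \<in> dyadic_interval j l"
      by (simp add: dyadic_interval_def)
    then show ?thesis
      using haar_const[OF that] by (intro haar_mult_integral_0) blast
  qed
  show ?thesis
    using *[of i j k l] *[of j i l k] assms by (cases "i \<le> j") (auto simp: mult.commute)
qed

section \<open>Finite orthogonal sums over an arbitrary measure space\<close>

lemma integrable_mult_of_squares:
  fixes f g :: "'a \<Rightarrow> real"
  assumes "f \<in> borel_measurable M" "g \<in> borel_measurable M"
    and "integrable M (\<lambda>x. (f x)\<^sup>2)" "integrable M (\<lambda>x. (g x)\<^sup>2)"
  shows "integrable M (\<lambda>x. f x * g x)"
proof (rule Bochner_Integration.integrable_bound)
  show "integrable M (\<lambda>x. (f x)\<^sup>2 + (g x)\<^sup>2)" using assms by simp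
  have "\<bar>f x * g x\<bar> \<le> (f x)\<^sup>2 + (g x)\<^sup>2" for x
    using sum_squares_bound[of "\<bar>f x\<bar>" "\<bar>g x\<bar>"] mult_nonneg_nonneg[OF abs_ge_zero abs_ge_zero, of "f x" "g x"]
    unfolding abs_mult power2_abs by linarith
  then show "AE x in M. norm (f x * g x) \<le> norm ((f x)\<^sup>2 + (g x)\<^sup>2)" by simp
qed (use assms in measurable)

text \<open>Coefficient extraction and Pythagoras. The measure is arbitrary because the result
  serves both the Haar functions on the half-line and their weighted differences on the product
  space.\<close>

lemma
  fixes u :: "'i \<Rightarrow> 'a \<Rightarrow> real"
  assumes fin: "finite A"
    and meas: "\<And>p. p \<in> A \<Longrightarrow> u p \<in> borel_measurable M"
    and int: "\<And>p. p \<in> A \<Longrightarrow> integrable M (\<lambda>x. (u p x)\<^sup>2)"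
    and orth: "\<And>p q. p \<in> A \<Longrightarrow> q \<in> A \<Longrightarrow> p \<noteq> q \<Longrightarrow> (\<integral>x. u p x * u q x \<partial>M) = 0"
  shows integral_mult_orthogonal_sum:
      "\<And>q. q \<in> A \<Longrightarrow> (\<integral>x. (\<Sum>p\<in>A. c p * u p x) * u q x \<partial>M) = c q * (\<integral>x. (u q x)\<^sup>2 \<partial>M)"
    and nn_integral_orthogonal_sum_sq:
      "(\<integral>\<^sup>+x. ennreal ((\<Sum>p\<in>A. c p * u p x)\<^sup>2) \<partial>M) = ennreal (\<Sum>p\<in>A. (c p)\<^sup>2 * (\<integral>x. (u p x)\<^sup>2 \<partial>M))"
proof -
  have prod: "integrable M (\<lambda>x. u p x * u q x)" if "p \<in> A" "q \<in> A" for p q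
    using that meas int by (intro integrable_mult_of_squares) auto
  have expand: "(\<Sum>p\<in>A. c p * u p x) * u q x = (\<Sum>p\<in>A. c p * (u p x * u q x))" for x q
    by (simp add: sum_distrib_right mult.assoc)
  have int_q: "integrable M (\<lambda>x. (\<Sum>p\<in>A. c p * u p x) * u q x)" if "q \<in> A" for q
    unfolding expand using prod that by (intro Bochner_Integration.integrable_sum) simp
  show coeff: "(\<integral>x. (\<Sum>p\<in>A. c p * u p x) * u q x \<partial>M) = c q * (\<integral>x. (u q x)\<^sup>2 \<partial>M)"
    if "q \<in> A" for q
  proof -
    have "(\<integral>x. (\<Sum>p\<in>A. c p * u p x) * u q x \<partial>M) = (\<Sum>p\<in>A. c p * (\<integral>x. u p x * u q x \<partial>M))"
      unfolding expand using prod that by (subst Bochner_Integration.integral_sum) auto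
    also have "\<dots> = (\<Sum>p\<in>A. if p = q then c q * (\<integral>x. (u q x)\<^sup>2 \<partial>M) else 0)"
      using that orth by (intro sum.cong) (auto simp: power2_eq_square)
    finally show ?thesis using fin that by simp
  qed
  \<comment> \<open>Only one of the two factors is expanded, so that the first claim evaluates each
    resulting integral.\<close>
  have sq: "(\<Sum>p\<in>A. c p * u p x)\<^sup>2 = (\<Sum>q\<in>A. c q * ((\<Sum>p\<in>A. c p * u p x) * u q x))" for x
    unfolding power2_eq_square by (simp add: sum_distrib_left mult_ac)
  have "integrable M (\<lambda>x. (\<Sum>p\<in>A. c p * u p x)\<^sup>2)"
    unfolding sq using int_q by (intro Bochner_Integration.integrable_sum) simp
  then have "(\<integral>\<^sup>+x. ennreal ((\<Sum>p\<in>A. c p * u p x)\<^sup>2) \<partial>M) = ennreal (\<integral>x. (\<Sum>p\<in>A. c p * u p x)\<^sup>2 \<partial>M)"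
    by (intro nn_integral_eq_integral) auto
  also have "(\<integral>x. (\<Sum>p\<in>A. c p * u p x)\<^sup>2 \<partial>M) = (\<Sum>p\<in>A. (c p)\<^sup>2 * (\<integral>x. (u p x)\<^sup>2 \<partial>M))"
    unfolding sq using int_q coeff
    by (subst Bochner_Integration.integral_sum) (auto simp: power2_eq_square mult.assoc)
  finally show "(\<integral>\<^sup>+x. ennreal ((\<Sum>p\<in>A. c p * u p x)\<^sup>2) \<partial>M) =
      ennreal (\<Sum>p\<in>A. (c p)\<^sup>2 * (\<integral>x. (u p x)\<^sup>2 \<partial>M))" .
qed

subsection \<open>Energy of Haar functions\<close>

lemma sigma_finite_leb_pos: "sigma_finite_measure leb_pos"
  by (intro sigma_finite_measure_restrict_space lborel.sigma_finite_measure_axioms) simp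

interpretation leb_pos: sigma_finite_measure leb_pos
  by (rule sigma_finite_leb_pos)

interpretation leb_pos_pair: pair_sigma_finite leb_pos leb_pos ..

lemma space_leb_pos_pair: "space (leb_pos \<Otimes>\<^sub>M leb_pos) = {0..} \<times> {0..}"
  by (simp add: space_pair_measure space_restrict_space)

text \<open>A signed square root of the energy integrand, linear in \<open>f\<close>, so that the
  energy becomes a squared norm.\<close>

definition weighted_diff :: "real \<Rightarrow> (real \<Rightarrow> real) \<Rightarrow> real \<times> real \<Rightarrow> real" where
  "weighted_diff s f p = (f (fst p) - f (snd p)) /
     (dyadic_dist (fst p) (snd p) powr s * sqrt (dyadic_dist (fst p) (snd p)))"

lemma weighted_diff_measurable [measurable]:
  assumes [measurable]: "f \<in> borel_measurable leb_pos"
  shows "weighted_diff s f \<in> borel_measurable (leb_pos \<Otimes>\<^sub>M leb_pos)"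
  unfolding weighted_diff_def[abs_def] by measurable

lemma dyadic_dist_nonneg: "dyadic_dist x y \<ge> 0"
  by (simp add: dyadic_dist_def)

lemma dyadic_energy_eq:
  "dyadic_energy s f = (\<integral>\<^sup>+p. ennreal ((weighted_diff s f p)\<^sup>2) \<partial>(leb_pos \<Otimes>\<^sub>M leb_pos))"
  unfolding dyadic_energy_def weighted_diff_def case_prod_beta
  by (simp add: power_divide power_mult_distrib dyadic_dist_nonneg)

lemma weighted_diff_swap: "weighted_diff s f (y, x) = - weighted_diff s f (x, y)"
  by (simp add: weighted_diff_def dyadic_dist_commute[of y x] minus_divide_left)

lemma weighted_diff_sum:
  "weighted_diff s (\<lambda>x. \<Sum>i\<in>A. c i * f i x) p = (\<Sum>i\<in>A. c i * weighted_diff s (f i) p)"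
  by (simp add: weighted_diff_def sum_subtractf[symmetric] sum_divide_distrib right_diff_distrib)

text \<open>If \<open>g\<close> is constant on the support \<open>I\<close> of \<open>haar j l\<close>, only pairs with exactly one point in
  \<open>I\<close> contribute. With the other point fixed outside \<open>I\<close>, the weight is constant on \<open>I\<close> and
  the Haar function integrates to \<open>0\<close>.\<close>

lemma weighted_diff_haar_integral_0:
  assumes c: "\<And>x. x \<in> dyadic_interval j l \<Longrightarrow> g x = c"
    and int: "integrable (leb_pos \<Otimes>\<^sub>M leb_pos) (\<lambda>p. weighted_diff s g p * weighted_diff s (haar j l) p)"
  shows "(LINT p|(leb_pos \<Otimes>\<^sub>M leb_pos). weighted_diff s g p * weighted_diff s (haar j l) p) = 0"
proof -
  let ?I = "dyadic_interval j l" and ?M = "leb_pos \<Otimes>\<^sub>M leb_pos"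
  define F where "F x y = weighted_diff s g (x, y) * weighted_diff s (haar j l) (x, y)" for x y
  \<comment> \<open>\<open>G\<close> is the part of the integrand with the first point in the
    support and the second outside it.\<close>
  define G where "G x y = indicator (?I \<times> - ?I) (x, y) * F x y" for x y
  have I: "?I \<in> sets leb_pos" "- ?I \<inter> space leb_pos \<in> sets leb_pos"
    using dyadic_interval_pos by (auto simp: sets_restrict_space_iff space_restrict_space)
  have F_eq: "case_prod F = (\<lambda>p. weighted_diff s g p * weighted_diff s (haar j l) p)"
    by (auto simp: F_def)
  have F_int: "integrable ?M (case_prod F)"
    using int unfolding F_eq .
  \<comment> \<open>The complement of the support is cut down to the underlying space to be
    measurable there; on that space the indicator stays the same.\<close>
  have "integrable ?M (\<lambda>p. indicator (?I \<times> (- ?I \<inter> space leb_pos)) p *\<^sub>R case_prod F p)"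
    using F_int I by (intro integrable_mult_indicator) auto
  then have G_int: "integrable ?M (case_prod G)"
    by (rule Bochner_Integration.integrable_cong[THEN iffD1, rotated -1])
       (auto simp: G_def space_pair_measure indicator_def)
  have inner: "(LINT x|leb_pos. G x y) = 0" if "y \<in> space leb_pos" for y
  proof (cases "y \<in> ?I")
    case False
    \<comment> \<open>The left endpoint serves as a reference point, so that the weight
      \<open>w\<close> does not involve \<open>x\<close>.\<close>
    define x0 where "x0 = real l * 2 powi (- j)"
    have x0: "x0 \<in> ?I" "x0 \<ge> 0"
      by (auto simp: x0_def dyadic_interval_def)
    define w where "w = dyadic_dist x0 y powr s * sqrt (dyadic_dist x0 y)"
    have "G x y = (c - g y) / (w * w) * haar j l x" if "x \<in> space leb_pos" for x
    proof (cases "x \<in> ?I")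
      case True
      then have "dyadic_dist x y = dyadic_dist x0 y"
        using dyadic_dist_const_off_interval[OF True x0(1) False] x0 that \<open>y \<in> space leb_pos\<close>
        by (simp add: space_restrict_space)
      then show ?thesis
        using True False by (simp add: G_def F_def weighted_diff_def c haar_outside w_def)
    qed (simp add: G_def haar_outside)
    then have "(LINT x|leb_pos. G x y) = (LINT x|leb_pos. (c - g y) / (w * w) * haar j l x)"
      by (intro Bochner_Integration.integral_cong) auto
    then show ?thesis by simp
  qed (simp add: G_def)
  have G0: "integral\<^sup>L ?M (case_prod G) = 0"
  proof -
    have "(LINT y|leb_pos. LINT x|leb_pos. G x y) = (LINT y|leb_pos. 0)"
      using inner by (intro Bochner_Integration.integral_cong refl)
    then show ?thesis
      using leb_pos_pair.integral_snd[OF G_int] by simp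
  qed
  \<comment> \<open>With both points in the support the difference of \<open>g\<close> vanishes,
    with both outside that of the Haar function does. In the mixed case both factors change sign
    under the swap, so \<open>F\<close> is symmetric.\<close>
  have split: "F x y = G x y + G y x" for x y
  proof (cases "x \<in> ?I \<longleftrightarrow> y \<in> ?I")
    case True
    then have "F x y = 0"
      by (auto simp: F_def weighted_diff_def c haar_outside)
    with True show ?thesis by (auto simp: G_def)
  next
    case False
    then show ?thesis
      by (auto simp: G_def F_def weighted_diff_swap[of s _ y x])
  qed
  have "integral\<^sup>L ?M (case_prod F) = integral\<^sup>L ?M (\<lambda>(x, y). G x y + G y x)"
    by (intro Bochner_Integration.integral_cong) (auto simp: split)
  also have "\<dots> = integral\<^sup>L ?M (case_prod G) + integral\<^sup>L ?M (\<lambda>(x, y). G y x)"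
    using G_int leb_pos_pair.integrable_product_swap[OF G_int]
    by (subst Bochner_Integration.integral_add[symmetric]) (simp_all add: case_prod_unfold)
  also have "\<dots> = 0"
    using leb_pos_pair.integral_product_swap[of "case_prod G"] G_int G0 by (auto simp: case_prod_beta)
  finally show ?thesis
    by (simp only: F_eq)
qed

section \<open>Integrals over ancestor intervals and the energy of one Haar function\<close>

lemma dyadic_interval_ancestor:
  "dyadic_interval j k \<subseteq> dyadic_interval (j - int m) (k div 2 ^ m)"
  by (auto simp: mem_dyadic_interval_iff level_index_diff zdiv_int)

text \<open>Over \<open>J \<times> J\<close> the two squares each contribute the length of
  \<open>J\<close>, since the Haar function has norm \<open>1\<close> and support in
  \<open>J\<close>. The cross term vanishes because its mean is \<open>0\<close>.\<close>

lemma haar_diff_sq_integral_ancestor: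
  assumes J: "J = dyadic_interval (j - int m) (k div 2 ^ m)"
  shows "(\<integral>\<^sup>+p. ennreal ((haar j k (fst p) - haar j k (snd p))\<^sup>2 * (indicator J (fst p) * indicator J (snd p)))
      \<partial>(leb_pos \<Otimes>\<^sub>M leb_pos)) = ennreal (2 * 2 powi (int m - j))"
proof -
  let ?h = "haar j k" and ?L = "2 powi (int m - j) :: real"
  have [measurable]: "J \<in> sets leb_pos"
    by (simp add: J dyadic_interval_leb_pos)
  have Jint: "integrable leb_pos (indicator J :: real \<Rightarrow> real)" "integral\<^sup>L leb_pos (indicator J) = ?L"
    by (simp_all add: J)
  \<comment> \<open>An indicator of \<open>J\<close> is absorbed by a Haar factor in the same
    variable.\<close>
  have supp: "?h x * indicator J x = ?h x" for x
    using dyadic_interval_ancestor[of j k m] haar_outside[of x j k] by (auto simp: J indicator_def)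
  have inner: "(\<integral>\<^sup>+y. ennreal ((?h x - ?h y)\<^sup>2 * (indicator J x * indicator J y)) \<partial>leb_pos) =
      ennreal (?L * (?h x)\<^sup>2 + indicator J x)" for x
  proof -
    have eq: "(?h x - ?h y)\<^sup>2 * (indicator J x * indicator J y) =
       (?h x)\<^sup>2 * indicator J y - (2 * ?h x) * ?h y + indicator J x * (?h y)\<^sup>2" for y
    proof -
      have "(?h x - ?h y)\<^sup>2 * (indicator J x * indicator J y) =
        (?h x * (?h x * indicator J x)) * indicator J y
         - 2 * (?h x * indicator J x) * (?h y * indicator J y)
         + indicator J x * (?h y * (?h y * indicator J y))"
        by (simp add: power2_eq_square algebra_simps)
      then show ?thesis by (simp only: supp power2_eq_square)
    qed
    have "integrable leb_pos (\<lambda>y. (?h x)\<^sup>2 * indicator J y - (2 * ?h x) * ?h y + indicator J x * (?h y)\<^sup>2)"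
      using Jint by simp
    moreover have "(LINT y|leb_pos. (?h x)\<^sup>2 * indicator J y - (2 * ?h x) * ?h y + indicator J x * (?h y)\<^sup>2)
        = ?L * (?h x)\<^sup>2 + indicator J x"
      using Jint by simp
    ultimately show ?thesis
      by (subst nn_integral_eq_integral) (simp_all only: eq[symmetric], simp_all)
  qed
  have "(\<integral>\<^sup>+p. ennreal ((?h (fst p) - ?h (snd p))\<^sup>2 * (indicator J (fst p) * indicator J (snd p)))
      \<partial>(leb_pos \<Otimes>\<^sub>M leb_pos)) =
     (\<integral>\<^sup>+x. \<integral>\<^sup>+y. ennreal ((?h x - ?h y)\<^sup>2 * (indicator J x * indicator J y)) \<partial>leb_pos \<partial>leb_pos)"
    by (subst leb_pos.nn_integral_fst[symmetric]) simp_all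
  also have "\<dots> = (\<integral>\<^sup>+x. ennreal (?L * (?h x)\<^sup>2 + indicator J x) \<partial>leb_pos)"
    by (simp only: inner)
  also have "\<dots> = ennreal (LINT x|leb_pos. ?L * (?h x)\<^sup>2 + indicator J x)"
    using Jint by (intro nn_integral_eq_integral) auto
  also have "(LINT x|leb_pos. ?L * (?h x)\<^sup>2 + indicator J x) = 2 * ?L"
    using Jint by simp
  finally show ?thesis .
qed

text \<open>The factor \<open>1 - q\<close> normalises the tail to a pure power. The cutoff
  \<open>M \<le> m\<close> will select the ancestors that contain both points.\<close>

lemma geometric_tail_sums:
  fixes q :: real
  assumes "0 < q" "q < 1"
  shows "(\<lambda>m. if M \<le> m then q ^ m * (1 - q) else 0) sums q ^ M"
proof -
  have "(\<lambda>m. q ^ m * (q ^ M * (1 - q))) sums (1 / (1 - q) * (q ^ M * (1 - q)))"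
    using assms by (intro sums_mult2 geometric_sums) simp
  then have "(\<lambda>m. if M \<le> m + M then q ^ (m + M) * (1 - q) else 0) sums q ^ M"
    using assms by (simp add: power_add mult_ac)
  then show ?thesis
    by (subst (asm) sums_iff_shift) simp
qed

text \<open>The weight of a pair telescopes into a sum over all dyadic intervals containing both points;
  where the Haar function takes different values, these are its support and the ancestors of that.\<close>

lemma weighted_diff_haar_sq:
  fixes s q :: real and j :: int and k :: nat
  assumes s: "s > 0" and q: "q = 2 powr (- (1 + 2 * s))"
    and p: "p \<in> space (leb_pos \<Otimes>\<^sub>M leb_pos)"
  defines "J \<equiv> \<lambda>m. dyadic_interval (j - int m) (k div 2 ^ m)"
  shows "(\<lambda>m. 2 powr (j * (1 + 2 * s)) * (1 - q) * q ^ m *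
      ((haar j k (fst p) - haar j k (snd p))\<^sup>2 * (indicator (J m) (fst p) * indicator (J m) (snd p))))
    sums (weighted_diff s (haar j k) p)\<^sup>2"
proof (cases "haar j k (fst p) = haar j k (snd p)")
  case True
  then show ?thesis by (simp add: weighted_diff_def)
next
  case False
  obtain x y where xy: "p = (x, y)" by (cases p)
  let ?d = "(haar j k x - haar j k y)\<^sup>2"
  have nn: "x \<ge> 0" "y \<ge> 0" "x \<noteq> y"
    using p False by (auto simp: xy space_leb_pos_pair)
  then obtain n where n: "last_common_level x y n"
    using ex_last_common_level by blast
  \<comment> \<open>Different Haar values force different indices at level
    \<open>j + 1\<close>.\<close>
  have "n \<le> j"
  proof -
    have "level_index (j + 1) x \<noteq> level_index (j + 1) y"
      using False by (auto simp: xy haar_level_index split: if_splits)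
    then show ?thesis using last_common_level_iff[OF n, of "j + 1"] by simp
  qed
  \<comment> \<open>The number of generations from the support up to the smallest interval around
    both points.\<close>
  define M where "M = nat (j - n)"
  then have M: "n = j - int M" using \<open>n \<le> j\<close> by simp
  have one: "x \<in> dyadic_interval j k \<or> y \<in> dyadic_interval j k"
    using False haar_outside by (metis xy fst_conv snd_conv)
  \<comment> \<open>One point already lies in the support, hence in every ancestor; the other joins
    it exactly when the indices at that level agree.\<close>
  have J: "x \<in> J m \<and> y \<in> J m \<longleftrightarrow> M \<le> m" for m
  proof -
    have "x \<in> J m \<or> y \<in> J m"
      using one dyadic_interval_ancestor[of j k m] by (auto simp: J_def)
    then have "x \<in> J m \<and> y \<in> J m \<longleftrightarrow> level_index (j - int m) x = level_index (j - int m) y"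
      by (auto simp: J_def mem_dyadic_interval_iff)
    also have "\<dots> \<longleftrightarrow> M \<le> m"
      using last_common_level_iff[OF n] by (simp add: M)
    finally show ?thesis .
  qed
  have q01: "0 < q" "q < 1"
    using s by (auto simp: q intro: powr_less_one)
  have "(\<lambda>m. 2 powr (j * (1 + 2 * s)) * ?d * (if M \<le> m then q ^ m * (1 - q) else 0))
     sums (2 powr (j * (1 + 2 * s)) * ?d * q ^ M)"
    by (intro sums_mult geometric_tail_sums q01)
  moreover have "2 powr (j * (1 + 2 * s)) * (1 - q) * q ^ m *
      (?d * (indicator (J m) x * indicator (J m) y)) =
      2 powr (j * (1 + 2 * s)) * ?d * (if M \<le> m then q ^ m * (1 - q) else 0)" for m
    using J[of m] by (auto simp: indicator_def)
  moreover have "(weighted_diff s (haar j k) p)\<^sup>2 = 2 powr (j * (1 + 2 * s)) * ?d * q ^ M"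
  proof -
    have d: "dyadic_dist x y = 2 powr (- n)"
      using dyadic_dist_eq[OF nn(1) n] powr_real_of_int'[of 2 "- n"] by simp
    have "(dyadic_dist x y powr s * sqrt (dyadic_dist x y))\<^sup>2 = 2 powr (- (n * (1 + 2 * s)))"
      unfolding d by (simp add: power_mult_distrib powr_powr power2_eq_square[of "_ powr _"] flip: powr_add)
        (rule arg_cong[of _ _ "(powr) 2"], simp add: algebra_simps)
    \<comment> \<open>Since \<open>n = j - int M\<close>, each generation above the support costs
      one factor \<open>q\<close>.\<close>
    moreover have "2 powr (n * (1 + 2 * s)) = 2 powr (j * (1 + 2 * s)) * q ^ M"
      by (simp add: q M powr_realpow[symmetric] powr_powr algebra_simps flip: powr_add)
    moreover have "(weighted_diff s (haar j k) p)\<^sup>2 =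
        ?d / (dyadic_dist x y powr s * sqrt (dyadic_dist x y))\<^sup>2"
      by (simp add: weighted_diff_def xy power_divide)
    ultimately show ?thesis
      by (simp add: powr_minus divide_inverse mult_ac)
  qed
  ultimately show ?thesis
    by (simp only: xy fst_conv snd_conv)
qed

text \<open>The energy of \<open>haar 0 k\<close>. The factor \<open>2\<close> comes from the two
  squares in the integral over an ancestor, the remaining numerator from the telescoping
  weights.\<close>

definition energy_const :: "real \<Rightarrow> real" where
  "energy_const s = 2 * (1 - 2 powr (- (1 + 2 * s))) / (1 - 2 powr (- 2 * s))"

lemma energy_const_pos: "s > 0 \<Longrightarrow> energy_const s > 0"
  by (auto simp: energy_const_def intro!: divide_pos_pos powr_less_one)

text \<open>Summing the telescoped weights over the ancestors of a dyadic interval of length \<open>2\<^sup>-\<^sup>j\<close> gives a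
  geometric series of ratio \<open>2\<^sup>-\<^sup>2\<^sup>s\<close>, whence the denominator of \<open>energy_const\<close>.\<close>

lemma dyadic_energy_haar:
  assumes s: "s > 0"
  shows "dyadic_energy s (haar j k) = ennreal (energy_const s * 2 powr (2 * s * j))"
proof -
  let ?M = "leb_pos \<Otimes>\<^sub>M leb_pos"
  define q :: real where "q = 2 powr (- (1 + 2 * s))"
  \<comment> \<open>\<open>t\<close> equals \<open>2 * q\<close>: one generation up, the weight
    shrinks by \<open>q\<close> while the interval doubles in length.\<close>
  define t :: real where "t = 2 powr (- 2 * s)"
  have q01: "0 < q" "q < 1" and t01: "0 < t" "t < 1"
    using s by (auto simp: q_def t_def intro!: powr_less_one)
  define J where "J m = dyadic_interval (j - int m) (k div 2 ^ m)" for m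
  define w where "w m = 2 powr (j * (1 + 2 * s)) * (1 - q) * q ^ m" for m
  define H where "H m p = (haar j k (fst p) - haar j k (snd p))\<^sup>2 *
     (indicator (J m) (fst p) * indicator (J m) (snd p))" for m p
  have w: "w m \<ge> 0" for m using q01 by (simp add: w_def)
  have H: "H m p \<ge> 0" for m p by (simp add: H_def)
  have [measurable]: "J m \<in> sets leb_pos" for m
    by (simp add: J_def dyadic_interval_leb_pos)
  have [measurable]: "H m \<in> borel_measurable ?M" for m
    unfolding H_def by measurable
  have "dyadic_energy s (haar j k) = (\<integral>\<^sup>+p. (\<Sum>m. ennreal (w m * H m p)) \<partial>?M)"
    unfolding dyadic_energy_eq
  proof (intro nn_integral_cong)
    fix p assume "p \<in> space ?M"
    then have "(\<lambda>m. w m * H m p) sums (weighted_diff s (haar j k) p)\<^sup>2"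
      unfolding w_def H_def J_def by (rule weighted_diff_haar_sq[OF s q_def])
    then show "ennreal ((weighted_diff s (haar j k) p)\<^sup>2) = (\<Sum>m. ennreal (w m * H m p))"
      using w H by (intro suminf_ennreal_eq[symmetric]) simp_all
  qed
  also have "\<dots> = (\<Sum>m. ennreal (w m) * (\<integral>\<^sup>+p. ennreal (H m p) \<partial>?M))"
    using w H by (simp add: nn_integral_suminf ennreal_mult nn_integral_cmult)
  also have "\<dots> = (\<Sum>m. ennreal (2 * (1 - q) * 2 powr (2 * s * j) * t ^ m))"
  proof -
    have "ennreal (w m) * (\<integral>\<^sup>+p. ennreal (H m p) \<partial>?M) =
        ennreal (2 * (1 - q) * 2 powr (2 * s * j) * t ^ m)" for m
    proof -
      have "(\<integral>\<^sup>+p. ennreal (H m p) \<partial>?M) = ennreal (2 * 2 powi (int m - j))"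
        unfolding H_def by (rule haar_diff_sq_integral_ancestor) (simp add: J_def)
      moreover have "2 powr (j * (1 + 2 * s)) * q ^ m * 2 powi (int m - j) = 2 powr (2 * s * j) * t ^ m"
        by (simp add: q_def t_def powr_realpow[symmetric] powr_powr powr_real_of_int'[symmetric] algebra_simps
            flip: powr_add)
      moreover have "w m * (2 * 2 powi (int m - j)) =
          2 * (1 - q) * (2 powr (j * (1 + 2 * s)) * q ^ m * 2 powi (int m - j))"
        by (simp add: w_def)
      ultimately show ?thesis
        using w[of m] by (simp add: ennreal_mult[symmetric] mult.assoc)
    qed
    then show ?thesis by simp
  qed
  also have "\<dots> = ennreal (2 * (1 - q) * 2 powr (2 * s * j) * (1 / (1 - t)))"
    using q01 t01 by (intro suminf_ennreal_eq sums_mult geometric_sums) auto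
  also have "\<dots> = ennreal (energy_const s * 2 powr (2 * s * j))"
    by (simp add: energy_const_def q_def t_def)
  finally show ?thesis .
qed

text \<open>The energy is finite, so its \<open>ennreal\<close> value yields integrability and a
  real integral, as the orthogonal expansion requires.\<close>

lemma weighted_diff_haar_sq_integrable:
    "s > 0 \<Longrightarrow> integrable (leb_pos \<Otimes>\<^sub>M leb_pos) (\<lambda>p. (weighted_diff s (haar j k) p)\<^sup>2)"
  and weighted_diff_haar_sq_integral:
    "s > 0 \<Longrightarrow> (LINT p|(leb_pos \<Otimes>\<^sub>M leb_pos). (weighted_diff s (haar j k) p)\<^sup>2) = energy_const s * 2 powr (2 * s * j)"
proof -
  assume s: "s > 0"
  have eq: "(\<integral>\<^sup>+p. ennreal ((weighted_diff s (haar j k) p)\<^sup>2) \<partial>(leb_pos \<Otimes>\<^sub>M leb_pos)) =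
      ennreal (energy_const s * 2 powr (2 * s * j))"
    using dyadic_energy_haar[OF s, of j k] by (simp add: dyadic_energy_eq)
  have nn: "energy_const s * 2 powr (2 * s * j) \<ge> 0"
    using energy_const_pos[OF s] by simp
  show "integrable (leb_pos \<Otimes>\<^sub>M leb_pos) (\<lambda>p. (weighted_diff s (haar j k) p)\<^sup>2)"
    using eq nn by (intro integrableI_nn_integral_finite) auto
  show "(LINT p|(leb_pos \<Otimes>\<^sub>M leb_pos). (weighted_diff s (haar j k) p)\<^sup>2) = energy_const s * 2 powr (2 * s * j)"
    using eq nn by (intro integral_eq_nn_integral[THEN trans]) (auto simp: eq)
qed

lemma weighted_diff_haar_orthogonal:
  assumes s: "s > 0" and ne: "(i, k) \<noteq> (j, l)"
  shows "(LINT p|(leb_pos \<Otimes>\<^sub>M leb_pos). weighted_diff s (haar i k) p * weighted_diff s (haar j l) p) = 0"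
proof -
  \<comment> \<open>As for the Haar functions themselves, the coarser one is put first and is
    constant on the support of the finer one.\<close>
  have *: "(LINT p|(leb_pos \<Otimes>\<^sub>M leb_pos). weighted_diff s (haar i k) p * weighted_diff s (haar j l) p) = 0"
    if "i \<le> j" "(i, k) \<noteq> (j, l)" for i k j l
  proof (rule weighted_diff_haar_integral_0)
    have "real l * 2 powi - j \<in> dyadic_interval j l"
      by (simp add: dyadic_interval_def)
    then show "haar i k x = haar i k (real l * 2 powi - j)" if "x \<in> dyadic_interval j l" for x
      using haar_const[OF \<open>i \<le> j\<close> \<open>(i, k) \<noteq> (j, l)\<close> that] by blast
  qed (intro integrable_mult_of_squares weighted_diff_haar_sq_integrable s; measurable)
  show ?thesis
    using *[of i j k l] *[of j i l k] ne by (cases "i \<le> j") (auto simp: mult.commute)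
qed

lemma dyadic_energy_haar_sum:
  assumes s: "s > 0" and fin: "finite A"
  shows "dyadic_energy s (\<lambda>x. \<Sum>(j,k)\<in>A. a j k * haar j k x) =
    ennreal (energy_const s * (\<Sum>(j,k)\<in>A. (a j k)\<^sup>2 * 2 powr (2 * s * j)))"
proof -
  have "weighted_diff s (\<lambda>x. \<Sum>(j,k)\<in>A. a j k * haar j k x) p =
      (\<Sum>q\<in>A. a (fst q) (snd q) * weighted_diff s (haar (fst q) (snd q)) p)" for p
    unfolding case_prod_beta by (rule weighted_diff_sum)
  then have "dyadic_energy s (\<lambda>x. \<Sum>(j,k)\<in>A. a j k * haar j k x) =
     (\<integral>\<^sup>+p. ennreal ((\<Sum>q\<in>A. a (fst q) (snd q) * weighted_diff s (haar (fst q) (snd q)) p)\<^sup>2)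
        \<partial>(leb_pos \<Otimes>\<^sub>M leb_pos))"
    by (simp add: dyadic_energy_eq)
  also have "\<dots> = ennreal (\<Sum>q\<in>A. (a (fst q) (snd q))\<^sup>2 *
      (LINT p|(leb_pos \<Otimes>\<^sub>M leb_pos). (weighted_diff s (haar (fst q) (snd q)) p)\<^sup>2))"
    by (rule nn_integral_orthogonal_sum_sq)
       (auto simp: fin weighted_diff_haar_sq_integrable[OF s] weighted_diff_haar_orthogonal[OF s])
  also have "\<dots> = ennreal (energy_const s * (\<Sum>(j,k)\<in>A. (a j k)\<^sup>2 * 2 powr (2 * s * j)))"
    by (simp add: weighted_diff_haar_sq_integral[OF s] case_prod_beta sum_distrib_left mult_ac)
  finally show ?thesis .
qed

subsection \<open>Dyadic derivatives in the Haar span\<close>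

lemma finite_fst_section: "finite A \<Longrightarrow> finite {j. (j, i) \<in> A}"
  by (rule finite_subset[of _ "fst ` A"]) force+

lemma inner_L2_haar_sum:
  assumes fin: "finite A"
  shows "inner_L2 (\<lambda>x. \<Sum>(j,k)\<in>A. a j k * haar j k x) (haar j i) = (if (j, i) \<in> A then a j i else 0)"
proof -
  \<comment> \<open>Padding \<open>A\<close> with \<open>(j, i)\<close> at coefficient
    \<open>0\<close> lets one orthogonal expansion cover both cases.\<close>
  define b where "b q = (if q \<in> A then a (fst q) (snd q) else 0)" for q
  have "(\<Sum>(j,k)\<in>A. a j k * haar j k x) = (\<Sum>q\<in>insert (j, i) A. b q * haar (fst q) (snd q) x)" for x
    unfolding case_prod_beta by (rule sum.mono_neutral_cong_left) (auto simp: fin b_def)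
  then have "inner_L2 (\<lambda>x. \<Sum>(j,k)\<in>A. a j k * haar j k x) (haar j i) =
     (LINT x|leb_pos. (\<Sum>q\<in>insert (j, i) A. b q * haar (fst q) (snd q) x) * haar (fst (j, i)) (snd (j, i)) x)"
    by (simp add: inner_L2_def)
  also have "\<dots> = b (j, i) * (LINT x|leb_pos. (haar (fst (j, i)) (snd (j, i)) x)\<^sup>2)"
    by (rule integral_mult_orthogonal_sum) (auto simp: fin haar_orthogonal)
  finally show ?thesis by (simp add: b_def)
qed

text \<open>Coefficients at indices outside \<open>A\<close> vanish, so the series over all levels
  is a finite sum.\<close>

lemma dyadic_deriv_haar_sum:
  assumes fin: "finite A"
  shows "dyadic_deriv s i (\<lambda>x. \<Sum>(j,k)\<in>A. a j k * haar j k x) x =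
    (\<Sum>j | (j, i) \<in> A. (2 powr (s * j) * a j i) * haar j i x)"
proof -
  note fin' = finite_fst_section[OF fin, of i]
  have "dyadic_deriv s i (\<lambda>x. \<Sum>(j,k)\<in>A. a j k * haar j k x) x =
     (\<Sum>\<^sub>\<infinity>j\<in>{j. (j, i) \<in> A}. (2 powr (s * j) * a j i) * haar j i x)"
    unfolding dyadic_deriv_def by (rule infsum_cong_neutral) (auto simp: inner_L2_haar_sum[OF fin])
  then show ?thesis by (simp add: infsum_finite[OF fin'])
qed

lemma L2_norm_sq_dyadic_deriv_haar_sum:
  assumes fin: "finite A"
  shows "L2_norm_sq (dyadic_deriv s i (\<lambda>x. \<Sum>(j,k)\<in>A. a j k * haar j k x)) =
    ennreal (\<Sum>j | (j, i) \<in> A. (a j i)\<^sup>2 * 2 powr (2 * s * j))"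
proof -
  note fin' = finite_fst_section[OF fin, of i]
  have "L2_norm_sq (dyadic_deriv s i (\<lambda>x. \<Sum>(j,k)\<in>A. a j k * haar j k x)) =
     ennreal (\<Sum>j | (j, i) \<in> A. (2 powr (s * j) * a j i)\<^sup>2 * (LINT x|leb_pos. (haar j i x)\<^sup>2))"
    unfolding L2_norm_sq_def dyadic_deriv_haar_sum[OF fin]
    by (rule nn_integral_orthogonal_sum_sq) (auto simp: fin' haar_orthogonal)
  moreover have "(2 powr (s * j) * a j i)\<^sup>2 = (a j i)\<^sup>2 * 2 powr (2 * s * j)" for j :: int
    by (simp add: power_mult_distrib power2_eq_square[of "_ powr _"] mult_ac flip: powr_add)
  ultimately show ?thesis by simp
qed

lemma suminf_L2_norm_sq_dyadic_deriv:
  assumes fin: "finite A"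
  shows "(\<Sum>i. L2_norm_sq (dyadic_deriv s i (\<lambda>x. \<Sum>(j,k)\<in>A. a j k * haar j k x))) =
    ennreal (\<Sum>(j,k)\<in>A. (a j k)\<^sup>2 * 2 powr (2 * s * j))"
proof -
  let ?g = "\<lambda>j i. (a j i)\<^sup>2 * 2 powr (2 * s * real_of_int j)"
  note fin' = finite_fst_section[OF fin]
  have "(\<Sum>i. L2_norm_sq (dyadic_deriv s i (\<lambda>x. \<Sum>(j,k)\<in>A. a j k * haar j k x))) =
     (\<Sum>i. ennreal (\<Sum>j | (j, i) \<in> A. ?g j i))"
    by (simp only: L2_norm_sq_dyadic_deriv_haar_sum[OF fin])
  \<comment> \<open>Only positions occurring in \<open>A\<close> contribute.\<close>
  also have "\<dots> = (\<Sum>i\<in>snd ` A. ennreal (\<Sum>j | (j, i) \<in> A. ?g j i))"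
  proof (rule suminf_finite)
    fix i assume "i \<notin> snd ` A"
    then have "{j. (j, i) \<in> A} = {}" by force
    then show "ennreal (\<Sum>j | (j, i) \<in> A. ?g j i) = 0" by simp
  qed (simp add: fin)
  also have "\<dots> = ennreal (\<Sum>i\<in>snd ` A. \<Sum>j | (j, i) \<in> A. ?g j i)"
    by (intro sum_ennreal sum_nonneg) simp
  \<comment> \<open>The fibres of \<open>snd\<close> partition \<open>A\<close>; the swap is needed
    because the dependent sum lists the position before the level.\<close>
  also have "(\<Sum>i\<in>snd ` A. \<Sum>j | (j, i) \<in> A. ?g j i) = (\<Sum>(j,k)\<in>A. ?g j k)"
    by (subst sum.Sigma)
       (auto simp: fin fin' intro!: sum.reindex_bij_witness[of _ prod.swap prod.swap] rev_image_eqI)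
  finally show ?thesis .
qed

lemma L2_ell2_norm_sq_eq_suminf:
  assumes "\<And>i. (\<lambda>x. F x i) \<in> borel_measurable leb_pos"
  shows "L2_ell2_norm_sq F = (\<Sum>i. L2_norm_sq (\<lambda>x. F x i))"
  unfolding L2_ell2_norm_sq_def ell2_norm_sq_def L2_norm_sq_def
  using assms by (intro nn_integral_suminf) simp

theorem proposition4p1:
  fixes s :: real
  assumes "0 < s" and "s < 1"
  shows "\<exists>c::real. c > 0 \<and>
    (\<forall>f\<in>haar_span.
       (dyadic_energy s f < \<infinity> \<longleftrightarrow> dyadic_gradient s f \<in> L2_ell2) \<and>
       dyadic_energy s f = ennreal c * L2_ell2_norm_sq (dyadic_gradient s f) \<and>
       dyadic_energy s f = ennreal c * (\<Sum>i. L2_norm_sq (dyadic_deriv s i f)))"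
proof (intro exI conjI ballI)
  show pos: "energy_const s > 0" by (rule energy_const_pos) fact
  fix f assume "f \<in> haar_span"
  then obtain A a where fin: "finite A" and f: "f = (\<lambda>x. \<Sum>(j,k)\<in>A. a j k * haar j k x)"
    by (auto simp: haar_span_def)
  \<comment> \<open>The common value of both gradient norms, and the energy up to the
    constant.\<close>
  let ?N = "\<Sum>(j,k)\<in>A. (a j k)\<^sup>2 * 2 powr (2 * s * real_of_int j)"
  have "?N \<ge> 0" by (intro sum_nonneg) auto
  have meas: "(\<lambda>x. dyadic_gradient s f x i) \<in> borel_measurable leb_pos" for i
    unfolding dyadic_gradient_def f dyadic_deriv_haar_sum[OF fin] by measurable
  have energy: "dyadic_energy s f = ennreal (energy_const s * ?N)"
    unfolding f by (rule dyadic_energy_haar_sum) fact+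
  have sum: "(\<Sum>i. L2_norm_sq (dyadic_deriv s i f)) = ennreal ?N"
    unfolding f by (rule suminf_L2_norm_sq_dyadic_deriv[OF fin])
  have grad: "L2_ell2_norm_sq (dyadic_gradient s f) = ennreal ?N"
    using L2_ell2_norm_sq_eq_suminf[of "dyadic_gradient s f", OF meas] sum by (simp add: dyadic_gradient_def)
  show "dyadic_energy s f = ennreal (energy_const s) * (\<Sum>i. L2_norm_sq (dyadic_deriv s i f))"
    "dyadic_energy s f = ennreal (energy_const s) * L2_ell2_norm_sq (dyadic_gradient s f)"
    using pos \<open>?N \<ge> 0\<close> by (simp_all add: energy sum grad ennreal_mult)
  \<comment> \<open>Both sides hold on the span: the energy and the gradient norm are images of real
    numbers in \<open>ennreal\<close>.\<close>
  show "dyadic_energy s f < \<infinity> \<longleftrightarrow> dyadic_gradient s f \<in> L2_ell2"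
    using meas by (simp add: L2_ell2_def energy grad)
qed

end
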